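(* The set of $3$-player games with a unique Nash equilibrium is not open: there exists a size $m_1\times m_2\times m_3$ such that the set of $3$-player games of this size having a unique (mixed) Nash equilibrium is not an open subset of the set of all $3$-player games of this size.
   Context: A finite $3$-player game of size $m_1\times m_2\times m_3$ has pure strategy sets $S^i$ with $|S^i|=m_i$ ($i=1,2,3$) and utility functions $U^i:S^1\times S^2\times S^3\to\mathbb{R}$. Fixing the strategy sets, the game is identified with its payoffs, a point of $(\mathbb{R}^{m_1m_2m_3})^3$, and openness refers to the usual topology of this space. Nash equilibria are taken in mixed strategies. *)

theory Defs
  imports "HOL-Analysis.Analysis"
begin

definition pure_profiles :: "nat \<Rightarrow> nat \<Rightarrow> nat \<Rightarrow> (nat \<times> nat \<times> nat) set" where
  "pure_profiles m1 m2 m3 = {..<m1} \<times> {..<m2} \<times> {..<m3}"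

text \<open>
  The game space is the set of payoff tuples with the usual topology of the Euclidean space
  of dimension 3 * m1 * m2 * m3. The sizes are numbers rather than types so that they can be
  quantified inside a formula. The points of the product topology are extensional functions,
  so \<open>U i s\<close> carries no information for a player \<open>i\<close> outside \<open>{1, 2, 3}\<close> or a pure strategy
  profile \<open>s\<close> outside \<open>pure_profiles m1 m2 m3\<close>.
\<close>

definition game_space :: "nat \<Rightarrow> nat \<Rightarrow> nat \<Rightarrow> (nat \<Rightarrow> nat \<times> nat \<times> nat \<Rightarrow> real) topology" where
  "game_space m1 m2 m3 =
     product_topology (\<lambda>_. product_topology (\<lambda>_. euclideanreal) (pure_profiles m1 m2 m3)) {1, 2, 3}"

text \<open>
  Mixed strategies are extensional as well; otherwise values at arguments outside
  \<open>{..<m}\<close> would destroy the uniqueness of every equilibrium.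
\<close>

definition mixed_strategies :: "nat \<Rightarrow> (nat \<Rightarrow> real) set" where
  "mixed_strategies m =
     {x \<in> {..<m} \<rightarrow>\<^sub>E UNIV. (\<forall>a<m. 0 \<le> x a) \<and> (\<Sum>a<m. x a) = 1}"

definition expected_utility ::
  "nat \<Rightarrow> nat \<Rightarrow> nat \<Rightarrow> (nat \<times> nat \<times> nat \<Rightarrow> real)
     \<Rightarrow> (nat \<Rightarrow> real) \<Rightarrow> (nat \<Rightarrow> real) \<Rightarrow> (nat \<Rightarrow> real) \<Rightarrow> real" where
  "expected_utility m1 m2 m3 u x y z =
     (\<Sum>(a, b, c)\<in>pure_profiles m1 m2 m3. x a * y b * z c * u (a, b, c))"

definition nash_equilibria ::
  "nat \<Rightarrow> nat \<Rightarrow> nat \<Rightarrow> (nat \<Rightarrow> nat \<times> nat \<times> nat \<Rightarrow> real)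
     \<Rightarrow> ((nat \<Rightarrow> real) \<times> (nat \<Rightarrow> real) \<times> (nat \<Rightarrow> real)) set" where
  "nash_equilibria m1 m2 m3 U =
     {(x, y, z).
        x \<in> mixed_strategies m1 \<and> y \<in> mixed_strategies m2 \<and> z \<in> mixed_strategies m3 \<and>
        (\<forall>x'\<in>mixed_strategies m1.
           expected_utility m1 m2 m3 (U 1) x' y z \<le> expected_utility m1 m2 m3 (U 1) x y z) \<and>
        (\<forall>y'\<in>mixed_strategies m2.
           expected_utility m1 m2 m3 (U 2) x y' z \<le> expected_utility m1 m2 m3 (U 2) x y z) \<and>
        (\<forall>z'\<in>mixed_strategies m3.
           expected_utility m1 m2 m3 (U 3) x y z' \<le> expected_utility m1 m2 m3 (U 3) x y z)}"

end

(*
  Write X = x0 - x1 and Y = y0 - y1, and let s be the probability that player 3 plays 1.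
  In the 2 x 2 x 2 game below, the gain of playing 0 over playing 1 is 2 Y - s for player 1
  and s - 2 X for player 2. For every fixed s this is a matching pennies game with unique
  equilibrium X = Y = s / 2. The gain of player 3 is X (2 Y - e), which is s (s - e) / 2 along
  these equilibria. For e = 0 this has a double zero at the end point s = 0 and is positive
  elsewhere, so s = 0 is the only equilibrium; for small e > 0 the double zero splits into
  the two equilibria s = 0 and s = e.
*)
theory Submission
  imports Defs
begin

text \<open>Here \<open>t\<close> is the probability of strategy 0, so the \<open>s\<close> of the
  overview is \<open>1 - r\<close> when player 3 plays \<open>binary_mix r\<close>.\<close>

definition binary_mix :: "real \<Rightarrow> nat \<Rightarrow> real" where
  "binary_mix t = (\<lambda>a\<in>{..<2}. if a = 0 then t else 1 - t)"

lemma binary_mix_simps [simp]: "binary_mix t 0 = t" "binary_mix t (Suc 0) = 1 - t"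
  by (simp_all add: binary_mix_def)

lemma mixed_strategies_2: "mixed_strategies 2 = binary_mix ` {0..1}"
proof
  show "mixed_strategies 2 \<subseteq> binary_mix ` {0..1}"
  proof
    fix x assume "x \<in> mixed_strategies 2"
    then have ext: "x \<in> extensional {..<2}" and "0 \<le> x 0" "0 \<le> x 1" "x 0 + x 1 = 1"
      by (auto simp: mixed_strategies_def PiE_def numeral_2_eq_2)
    moreover from this have "x = binary_mix (x 0)"
      by (intro extensionalityI[OF ext])
        (auto simp: binary_mix_def less_Suc_eq numeral_2_eq_2)
    ultimately show "x \<in> binary_mix ` {0..1}"
      by (intro image_eqI[of _ _ "x 0"]) auto
  qed
  show "binary_mix ` {0..1} \<subseteq> mixed_strategies 2"
    by (auto simp: mixed_strategies_def binary_mix_def numeral_2_eq_2 split: if_splits)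
qed

lemma expected_utility_2_2_2:
  "expected_utility 2 2 2 u x y z =
     (\<Sum>a<2. \<Sum>b<2. \<Sum>c<2. x a * y b * z c * u (a, b, c))"
  by (simp add: expected_utility_def pure_profiles_def sum.cartesian_product split_def)

definition sign :: "nat \<Rightarrow> real" where
  "sign a = (if a = 0 then 1 else - 1)"

text \<open>Strategy 1 always pays its owner 0, so the entry for strategy 0 is directly the gain of
  playing 0 over playing 1.\<close>

definition payoff :: "real \<Rightarrow> nat \<Rightarrow> nat \<times> nat \<times> nat \<Rightarrow> real" where
  "payoff e i = (\<lambda>(a, b, c).
     if i = 1 then (if a = 0 then 2 * sign b - of_bool (c = 1) else 0)
     else if i = 2 then (if b = 0 then of_bool (c = 1) - 2 * sign a else 0)
     else (if c = 0 then sign a * (2 * sign b - e) else 0))"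

definition splitting_game :: "real \<Rightarrow> nat \<Rightarrow> nat \<times> nat \<times> nat \<Rightarrow> real" where
  "splitting_game e = (\<lambda>i\<in>{1, 2, 3}. \<lambda>s\<in>pure_profiles 2 2 2. payoff e i s)"

lemma expected_utility_splitting_game:
  fixes p q r e :: real
  defines "EU \<equiv> \<lambda>i. expected_utility 2 2 2 (splitting_game e i)
                      (binary_mix p) (binary_mix q) (binary_mix r)"
  shows "EU 1 = p * (2 * (2 * q - 1) - (1 - r))"
    and "EU 2 = q * ((1 - r) - 2 * (2 * p - 1))"
    and "EU 3 = r * ((2 * p - 1) * (2 * (2 * q - 1) - e))"
  unfolding EU_def expected_utility_2_2_2
  by (simp_all add: splitting_game_def pure_profiles_def payoff_def sign_def
      numeral_2_eq_2 lessThan_Suc algebra_simps)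

text \<open>A player's own gain does not depend on that player's own mix, so a deviation to
  \<open>t\<close> only replaces the factor in front of it.\<close>

lemma nash_splitting_game_iff:
  "(binary_mix p, binary_mix q, binary_mix r) \<in> nash_equilibria 2 2 2 (splitting_game e) \<longleftrightarrow>
     {binary_mix p, binary_mix q, binary_mix r} \<subseteq> mixed_strategies 2 \<and>
     (\<forall>t\<in>{0..1}. t * (2 * (2 * q - 1) - (1 - r)) \<le> p * (2 * (2 * q - 1) - (1 - r))) \<and>
     (\<forall>t\<in>{0..1}. t * ((1 - r) - 2 * (2 * p - 1)) \<le> q * ((1 - r) - 2 * (2 * p - 1))) \<and>
     (\<forall>t\<in>{0..1}. t * ((2 * p - 1) * (2 * (2 * q - 1) - e))
                  \<le> r * ((2 * p - 1) * (2 * (2 * q - 1) - e)))"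
  unfolding nash_equilibria_def mixed_strategies_2
  by (simp add: expected_utility_splitting_game del: One_nat_def)

text \<open>A linear function on the unit interval is either constant or maximal at exactly one end
  point; comparing with \<open>t = 0\<close> and \<open>t = 1\<close> suffices.\<close>

lemma best_response_cases:
  fixes p d :: real
  assumes "p \<in> {0..1}" and best: "\<forall>t\<in>{0..1}. t * d \<le> p * d"
  shows "d = 0 \<or> (d > 0 \<and> p = 1) \<or> (d < 0 \<and> p = 0)"
proof -
  have "d \<le> p * d" "0 \<le> p * d"
    using best[rule_format, of 1] best[rule_format, of 0] by auto
  then show ?thesis
    using assms(1) by (cases d "0 :: real" rule: linorder_cases)
      (auto simp: zero_le_mult_iff mult_le_cancel_right1)
qed

lemma nash_splitting_game_0:
  "nash_equilibria 2 2 2 (splitting_game 0) = {(binary_mix (1/2), binary_mix (1/2), binary_mix 1)}"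
proof
  show "nash_equilibria 2 2 2 (splitting_game 0)
          \<subseteq> {(binary_mix (1/2), binary_mix (1/2), binary_mix 1)}"
  proof
    fix w assume w: "w \<in> nash_equilibria 2 2 2 (splitting_game 0)"
    then obtain p q r where pqr: "p \<in> {0..1}" "q \<in> {0..1}" "r \<in> {0..1}"
      and w_eq: "w = (binary_mix p, binary_mix q, binary_mix r)"
      by (auto simp: nash_equilibria_def mixed_strategies_2)
    note eq = w[unfolded w_eq nash_splitting_game_iff]
    define A where "A = 2 * (2 * q - 1) - (1 - r)"
    define B where "B = (1 - r) - 2 * (2 * p - 1)"
    \<comment> \<open>The subtracted \<open>0\<close> is the parameter \<open>e\<close>.\<close>
    define C where "C = (2 * p - 1) * (2 * (2 * q - 1) - 0)"
    have A: "A = 0 \<or> (A > 0 \<and> p = 1) \<or> (A < 0 \<and> p = 0)"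
      unfolding A_def by (rule best_response_cases) (use eq pqr in auto)
    have B: "B = 0 \<or> (B > 0 \<and> q = 1) \<or> (B < 0 \<and> q = 0)"
      unfolding B_def by (rule best_response_cases) (use eq pqr in auto)
    have C: "C = 0 \<or> (C > 0 \<and> r = 1) \<or> (C < 0 \<and> r = 0)"
      unfolding C_def by (rule best_response_cases) (use eq pqr in auto)
    \<comment> \<open>Matching pennies: \<open>A > 0\<close> forces \<open>p = 1\<close>, then
      \<open>B < 0\<close> and \<open>q = 0\<close>, which makes \<open>A\<close> negative. The
      other signs run into the same cycle, since \<open>1 - r\<close> is at most 1 and cannot
      outweigh the terms \<plusminus>2.\<close>
    have "A = 0" "B = 0"
      using A B pqr unfolding A_def B_def by auto
    have p: "p = 1/2 + (1 - r) / 4"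
      using \<open>B = 0\<close> by (simp add: B_def field_simps)
    have q: "q = 1/2 + (1 - r) / 4"
      using \<open>A = 0\<close> by (simp add: A_def field_simps)
    have "C = (1 - r)\<^sup>2 / 2"
      unfolding C_def p q by (simp add: power2_eq_square field_simps)
    \<comment> \<open>The square rules out \<open>C < 0\<close>, and both remaining cases give
      \<open>r = 1\<close>.\<close>
    then have "r = 1"
      using C by auto
    then show "w \<in> {(binary_mix (1/2), binary_mix (1/2), binary_mix 1)}"
      unfolding w_eq p q by simp
  qed
  show "{(binary_mix (1/2), binary_mix (1/2), binary_mix 1)}
          \<subseteq> nash_equilibria 2 2 2 (splitting_game 0)"
    by (simp add: nash_splitting_game_iff mixed_strategies_2)
qed

text \<open>With X = Y = s/2 the first two gains vanish, and the third is s (s - e) / 2, which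
  vanishes at both roots. All players are thus indifferent.\<close>

lemma nash_splitting_game:
  assumes "s = 0 \<or> s = e" "0 \<le> e" "e \<le> 1"
  shows "(binary_mix (1/2 + s/4), binary_mix (1/2 + s/4), binary_mix (1 - s))
           \<in> nash_equilibria 2 2 2 (splitting_game e)"
  using assms by (auto simp: nash_splitting_game_iff mixed_strategies_2)

lemma not_unique_nash_splitting_game:
  assumes "0 < e" "e \<le> 1"
  shows "\<not> (\<exists>!w. w \<in> nash_equilibria 2 2 2 (splitting_game e))"
proof
  assume "\<exists>!w. w \<in> nash_equilibria 2 2 2 (splitting_game e)"
  with nash_splitting_game[of 0 e] nash_splitting_game[of e e] assms
  have "binary_mix (1 - 0) = binary_mix (1 - e)"
    by auto
  \<comment> \<open>Evaluating player 3's strategy at 0 tells the two equilibria apart.\<close>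
  then have "binary_mix (1 - 0) 0 = binary_mix (1 - e) 0"
    by (rule fun_cong)
  with assms show False
    by simp
qed

text \<open>Each payoff entry is affine in \<open>e\<close>, so the games form a continuous curve
  along which openness can be tested.\<close>

lemma continuous_map_splitting_game:
  "continuous_map euclideanreal (game_space 2 2 2) splitting_game"
proof -
  have "continuous_map euclideanreal euclideanreal (\<lambda>e. payoff e i s)" for i s
    by (cases s; cases "i = 1"; cases "i = 2"; cases "snd (snd s) = 0")
      (auto simp: payoff_def intro!: continuous_intros)
  then show ?thesis
    unfolding game_space_def splitting_game_def
    by (auto simp: continuous_map_componentwise cong: if_cong)
qed

theorem mainTheorem3:
  "\<exists>m1 m2 m3 :: nat. m1 \<ge> 1 \<and> m2 \<ge> 1 \<and> m3 \<ge> 1 \<and>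
     \<not> openin (game_space m1 m2 m3)
         {U \<in> topspace (game_space m1 m2 m3). \<exists>!p. p \<in> nash_equilibria m1 m2 m3 U}"
proof -
  let ?S = "{U \<in> topspace (game_space 2 2 2). \<exists>!p. p \<in> nash_equilibria 2 2 2 U}"
  have "\<not> openin (game_space 2 2 2) ?S"
  proof
    assume "openin (game_space 2 2 2) ?S"
    then have "open {e. splitting_game e \<in> ?S}"
      using openin_continuous_map_preimage[OF continuous_map_splitting_game] by force
    moreover have "splitting_game e \<in> topspace (game_space 2 2 2)" for e
      using continuous_map_splitting_game by (auto simp: continuous_map_def)
    then have "0 \<in> {e. splitting_game e \<in> ?S}"
      by (simp add: nash_splitting_game_0)
    ultimately obtain d where "d > 0" and ball: "ball 0 d \<subseteq> {e. splitting_game e \<in> ?S}"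
      by (meson open_contains_ball)
    \<comment> \<open>Half the radius stays inside the ball; the cap 1 keeps \<open>1 - e\<close> a
      probability.\<close>
    define e where "e = min 1 (d/2)"
    have "0 < e" "e \<le> 1" "e \<in> ball 0 d"
      using \<open>d > 0\<close> by (auto simp: e_def)
    with ball not_unique_nash_splitting_game show False
      by blast
  qed
  then show ?thesis
    by (intro exI[of _ 2]) auto
qed

end
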